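(* Let $n\ge 1$ and let $x_1,\dots,x_n$ be pairwise uncorrelated real-valued random variables, where $x_i$ has mean $\mu_i$ and finite variance $\sigma_i^2>0$. For real parameters $\alpha=(\alpha_1,\dots,\alpha_n)$ with $\sum_{i=1}^n\alpha_i=1$, consider the linear estimator $y_{n,\alpha}(x_1,\dots,x_n)=\sum_{i=1}^n\alpha_i x_i$. Then, among all $\alpha\in\mathbb{R}^n$ with $\sum_{i=1}^n\alpha_i=1$, the variance of $y_{n,\alpha}(x_1,\dots,x_n)$ is minimized for $$\alpha_i=\frac{1/\sigma_i^2}{\sum_{j=1}^n 1/\sigma_j^2}\qquad(1\le i\le n).$$
   Context: Random variables are pairwise uncorrelated if the covariance of every pair of distinct ones is zero. The means $\mu_i$ are not assumed equal, and no assumption is made on the form of the distributions. *)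

theory Defs
  imports "HOL-Probability.Probability"
begin

context prob_space
begin

(* Meaningful only when X, Y and the product of their deviations are integrable (as holds for
   variables of finite variance): a Bochner integral that does not exist is 0. *)
definition covariance :: "('a \<Rightarrow> real) \<Rightarrow> ('a \<Rightarrow> real) \<Rightarrow> real" where
  "covariance X Y = expectation (\<lambda>\<omega>. (X \<omega> - expectation X) * (Y \<omega> - expectation Y))"

(* The constant pairwise ranges over distinct indices only. *)
definition pairwise_uncorrelated :: "('i \<Rightarrow> 'a \<Rightarrow> real) \<Rightarrow> 'i set \<Rightarrow> bool" where
  "pairwise_uncorrelated X I \<longleftrightarrow> pairwise (\<lambda>i j. covariance (X i) (X j) = 0) I"

end

definition linear_estimator :: "nat \<Rightarrow> (nat \<Rightarrow> real) \<Rightarrow> (nat \<Rightarrow> 'a \<Rightarrow> real) \<Rightarrow> 'a \<Rightarrow> real" where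
  "linear_estimator n \<alpha> x = (\<lambda>\<omega>. \<Sum>i=1..n. \<alpha> i * x i \<omega>)"

end

theory Submission
  imports Defs
begin

text \<open>Uncorrelatedness makes the variance the diagonal quadratic form
  \<open>\<Sum>i. w\<^sub>i \<alpha>\<^sub>i\<^sup>2\<close> with \<open>w\<^sub>i = \<sigma>\<^sub>i\<^sup>2\<close>. The claimed minimizer \<open>\<beta>\<close> has \<open>w\<^sub>i \<beta>\<^sub>i\<close> constant in \<open>i\<close>,
  so \<open>\<alpha> - \<beta>\<close>, whose entries sum to \<open>0\<close>, is orthogonal to \<open>\<beta>\<close> with respect to this form and
  the form at \<open>\<alpha>\<close> exceeds its value at \<open>\<beta>\<close> by \<open>\<Sum>i. w\<^sub>i (\<alpha>\<^sub>i - \<beta>\<^sub>i)\<^sup>2\<close>.\<close>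

text \<open>The product is dominated pointwise by the sum of the two squares. Applied to deviations
  from the mean, this makes every covariance a genuine integral rather than the default value
  0.\<close>

lemma integrable_mult_of_integrable_power2:
  fixes f g :: "'a \<Rightarrow> real"
  assumes [measurable]: "f \<in> borel_measurable M" "g \<in> borel_measurable M"
    and "integrable M (\<lambda>\<omega>. (f \<omega>)\<^sup>2)" "integrable M (\<lambda>\<omega>. (g \<omega>)\<^sup>2)"
  shows "integrable M (\<lambda>\<omega>. f \<omega> * g \<omega>)"
proof (rule Bochner_Integration.integrable_bound)
  show "integrable M (\<lambda>\<omega>. (f \<omega>)\<^sup>2 + (g \<omega>)\<^sup>2)"
    using assms by simp
  have "\<bar>a * b\<bar> \<le> a\<^sup>2 + b\<^sup>2" for a b :: real
    using sum_squares_bound[of "\<bar>a\<bar>" "\<bar>b\<bar>"] abs_ge_zero[of "a * b"]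
    unfolding abs_mult power2_abs by linarith
  then show "AE \<omega> in M. norm (f \<omega> * g \<omega>) \<le> norm ((f \<omega>)\<^sup>2 + (g \<omega>)\<^sup>2)"
    by simp
qed measurable

context prob_space
begin

text \<open>Squaring the centred sum gives a double sum whose off-diagonal terms are multiples of
  covariances, hence vanish in expectation.\<close>

lemma variance_sum_uncorrelated:
  fixes X :: "'i \<Rightarrow> 'a \<Rightarrow> real"
  assumes "finite I"
    and int: "\<And>i. i \<in> I \<Longrightarrow> integrable M (X i)"
    and sq: "\<And>i. i \<in> I \<Longrightarrow> integrable M (\<lambda>\<omega>. (X i \<omega> - expectation (X i))\<^sup>2)"
    and unc: "pairwise_uncorrelated X I"
  shows "variance (\<lambda>\<omega>. \<Sum>i\<in>I. a i * X i \<omega>) = (\<Sum>i\<in>I. (a i)\<^sup>2 * variance (X i))"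
proof -
  define D where "D i \<omega> = X i \<omega> - expectation (X i)" for i \<omega>
  have prod: "integrable M (\<lambda>\<omega>. D i \<omega> * D j \<omega>)" if "i \<in> I" "j \<in> I" for i j
    unfolding D_def using that int sq
    by (intro integrable_mult_of_integrable_power2 borel_measurable_diff
        borel_measurable_const borel_measurable_integrable) auto
  have off: "expectation (\<lambda>\<omega>. D i \<omega> * D j \<omega>) = 0" if "i \<in> I" "j \<in> I" "i \<noteq> j" for i j
    using unc that unfolding pairwise_uncorrelated_def covariance_def pairwise_def D_def by blast
  have "expectation (\<lambda>\<omega>. \<Sum>i\<in>I. a i * X i \<omega>) = (\<Sum>i\<in>I. a i * expectation (X i))"
    using int by (simp add: Bochner_Integration.integral_sum)
  then have "variance (\<lambda>\<omega>. \<Sum>i\<in>I. a i * X i \<omega>) = expectation (\<lambda>\<omega>. (\<Sum>i\<in>I. a i * D i \<omega>)\<^sup>2)"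
    by (simp add: D_def right_diff_distrib sum_subtractf)
  also have "\<dots> = expectation (\<lambda>\<omega>. \<Sum>i\<in>I. \<Sum>j\<in>I. (a i * a j) * (D i \<omega> * D j \<omega>))"
    by (simp add: power2_eq_square sum_product mult_ac)
  \<comment> \<open>Exchanging expectation and double sum rests on the integrability of each
    product, given by \<open>prod\<close>.\<close>
  also have "\<dots> = (\<Sum>i\<in>I. \<Sum>j\<in>I. (a i * a j) * expectation (\<lambda>\<omega>. D i \<omega> * D j \<omega>))"
    using prod by (simp add: Bochner_Integration.integral_sum)
  also have "\<dots> = (\<Sum>i\<in>I. \<Sum>j\<in>I. if j = i then (a i)\<^sup>2 * variance (X i) else 0)"
    using off by (intro sum.cong refl) (auto simp: power2_eq_square D_def)
  also have "\<dots> = (\<Sum>i\<in>I. (a i)\<^sup>2 * variance (X i))"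
    using \<open>finite I\<close> by simp
  finally show ?thesis .
qed

end

lemma weighted_sum_squares_minimal:
  fixes w :: "'i \<Rightarrow> real"
  assumes "finite I" "I \<noteq> {}" and pos: "\<And>i. i \<in> I \<Longrightarrow> w i > 0"
  shows "is_arg_min (\<lambda>a. \<Sum>i\<in>I. (a i)\<^sup>2 * w i) (\<lambda>a. (\<Sum>i\<in>I. a i) = 1)
           (\<lambda>i. (1 / w i) / (\<Sum>j\<in>I. 1 / w j))"
proof -
  define S where "S = (\<Sum>j\<in>I. 1 / w j)"
  define b where "b i = (1 / w i) / S" for i
  \<comment> \<open>Nonemptiness of \<open>I\<close> enters here; it lets division by
    \<open>S\<close> normalise the weights to total 1.\<close>
  have "S > 0"
    unfolding S_def using assms by (intro sum_pos) auto
  then have b1: "(\<Sum>i\<in>I. b i) = 1"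
    unfolding b_def sum_divide_distrib[symmetric] S_def[symmetric] by simp
  have "(\<Sum>i\<in>I. (b i)\<^sup>2 * w i) \<le> (\<Sum>i\<in>I. (a i)\<^sup>2 * w i)" if a1: "(\<Sum>i\<in>I. a i) = 1" for a
  proof -
    \<comment> \<open>Expand the square of \<open>a i = b i + (a i - b i)\<close>. The cross term
      has coefficient \<open>2 * (b i * w i)\<close>, which is \<open>2 / S\<close> for every
      \<open>i\<close>, so after summation it is a multiple of \<open>1 - 1 = 0\<close>.\<close>
    have "(a i)\<^sup>2 * w i = (b i)\<^sup>2 * w i + (a i - b i)\<^sup>2 * w i + 2 / S * (a i - b i)" if "i \<in> I" for i
    proof -
      have "b i * w i = 1 / S"
        using pos[OF that] by (simp add: b_def)
      moreover have "(a i)\<^sup>2 * w i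
          = (b i)\<^sup>2 * w i + (a i - b i)\<^sup>2 * w i + 2 * (b i * w i) * (a i - b i)"
        by (simp add: power2_eq_square algebra_simps)
      ultimately show ?thesis
        by simp
    qed
    then have "(\<Sum>i\<in>I. (a i)\<^sup>2 * w i) = (\<Sum>i\<in>I. (b i)\<^sup>2 * w i) + (\<Sum>i\<in>I. (a i - b i)\<^sup>2 * w i)
        + 2 / S * ((\<Sum>i\<in>I. a i) - (\<Sum>i\<in>I. b i))"
      by (simp add: sum.distrib sum_subtractf flip: sum_distrib_left sum_divide_distrib)
    moreover have "(\<Sum>i\<in>I. (a i - b i)\<^sup>2 * w i) \<ge> 0"
      using pos by (intro sum_nonneg) (simp add: less_imp_le)
    ultimately show ?thesis
      by (simp add: a1 b1)
  qed
  with b1 show ?thesis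
    unfolding is_arg_min_linorder b_def S_def by blast
qed

theorem theorem3p2:
  fixes M :: "'a measure" and n :: nat
    and x :: "nat \<Rightarrow> 'a \<Rightarrow> real" and \<mu> \<sigma> :: "nat \<Rightarrow> real"
  assumes "prob_space M"
    and "n \<ge> 1"
    and "\<And>i. i \<in> {1..n} \<Longrightarrow> x i \<in> borel_measurable M"
    and "\<And>i. i \<in> {1..n} \<Longrightarrow> integrable M (x i)"
    and "\<And>i. i \<in> {1..n} \<Longrightarrow> prob_space.expectation M (x i) = \<mu> i"
    and "\<And>i. i \<in> {1..n} \<Longrightarrow> integrable M (\<lambda>\<omega>. (x i \<omega> - \<mu> i)\<^sup>2)"
    and "\<And>i. i \<in> {1..n} \<Longrightarrow> prob_space.variance M (x i) = (\<sigma> i)\<^sup>2"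
    and "\<And>i. i \<in> {1..n} \<Longrightarrow> (\<sigma> i)\<^sup>2 > 0"
    and "prob_space.pairwise_uncorrelated M x {1..n}"
  shows "is_arg_min (\<lambda>\<alpha>. prob_space.variance M (linear_estimator n \<alpha> x))
           (\<lambda>\<alpha>. (\<Sum>i=1..n. \<alpha> i) = 1)
           (\<lambda>i. (1 / (\<sigma> i)\<^sup>2) / (\<Sum>j=1..n. 1 / (\<sigma> j)\<^sup>2))"
proof -
  interpret prob_space M by fact
  \<comment> \<open>Since \<open>\<mu> i\<close> is the expectation of \<open>x i\<close>,
    integrability of the squared deviation from \<open>\<mu> i\<close> is the second-moment
    condition required for the variance formula.\<close>
  have "variance (linear_estimator n \<alpha> x) = (\<Sum>i=1..n. (\<alpha> i)\<^sup>2 * (\<sigma> i)\<^sup>2)" for \<alpha>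
    unfolding linear_estimator_def using assms
    by (subst variance_sum_uncorrelated) auto
  moreover have "is_arg_min (\<lambda>\<alpha>. \<Sum>i=1..n. (\<alpha> i)\<^sup>2 * (\<sigma> i)\<^sup>2) (\<lambda>\<alpha>. (\<Sum>i=1..n. \<alpha> i) = 1)
      (\<lambda>i. (1 / (\<sigma> i)\<^sup>2) / (\<Sum>j=1..n. 1 / (\<sigma> j)\<^sup>2))"
    using assms by (intro weighted_sum_squares_minimal) auto
  ultimately show ?thesis
    by simp
qed

end
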